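(* Let $n\ge1$. If $\varphi\in L^\infty(\mathbb{R}^n)$, $0\notin sp(\varphi)$ and $P\varphi\in C_u(\mathbb{R}^n)$, then $P\varphi$ is bounded.
   Context: Functions agreeing almost everywhere are identified. $P\varphi(x_1,\dots,x_n)=\int_0^{x_1}\varphi(t,x_2,\dots,x_n)\,dt$. $C_u(\mathbb{R}^n)$ is the space of uniformly continuous functions $\mathbb{R}^n\to\mathbb{C}$. The dual group of $\mathbb{R}^n$ is identified with $\mathbb{R}^n$ (unit $0$): $\hat f(\lambda)=\int_{\mathbb{R}^n}f(x)e^{-i x\cdot\lambda}\,dx$ for $f\in L^1(\mathbb{R}^n)$. $f^*(x)=\overline{f(-x)}$ and $f^**\varphi(x)=\int f^*(x-y)\varphi(y)\,dy$. For $\varphi\in L^\infty(\mathbb{R}^n)$, $sp(\varphi)=\{\lambda\in\mathbb{R}^n:\hat f(\lambda)=0\text{ for all }f\in L^1(\mathbb{R}^n)\text{ with }f^**\varphi=0\}$. *)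

theory Defs
  imports "HOL-Analysis.Analysis"
begin

definition L_one :: "(real^'n \<Rightarrow> complex) \<Rightarrow> bool" where
  "L_one f \<longleftrightarrow> integrable lebesgue f"

definition L_infinity :: "(real^'n \<Rightarrow> complex) \<Rightarrow> bool" where
  "L_infinity \<phi> \<longleftrightarrow> \<phi> \<in> borel_measurable lebesgue \<and> (\<exists>C. AE x in lebesgue. norm (\<phi> x) \<le> C)"

definition fourier :: "(real^'n \<Rightarrow> complex) \<Rightarrow> real^'n \<Rightarrow> complex" where
  "fourier f l = (LINT x|lebesgue. f x * exp (- (\<i> * complex_of_real (x \<bullet> l))))"

definition star :: "(real^'n \<Rightarrow> complex) \<Rightarrow> real^'n \<Rightarrow> complex" where
  "star f x = cnj (f (- x))"

definition conv :: "(real^'n \<Rightarrow> complex) \<Rightarrow> (real^'n \<Rightarrow> complex) \<Rightarrow> real^'n \<Rightarrow> complex" where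
  "conv f \<phi> x = (LINT y|lebesgue. f (x - y) * \<phi> y)"

text \<open>Functions agreeing almost everywhere are identified, so the vanishing of the convolution
  below is meant almost everywhere.\<close>

definition sp :: "(real^'n \<Rightarrow> complex) \<Rightarrow> (real^'n) set" where
  "sp \<phi> = {l. \<forall>f. L_one f \<and> (AE x in lebesgue. conv (star f) \<phi> x = 0) \<longrightarrow> fourier f l = 0}"

text \<open>The coordinates are indexed by a finite linearly ordered type, and the coordinate written
  \<open>x\<^sub>1\<close> in the literature is the one with the least index. The integral is oriented, i.e. it is
  minus the integral from \<open>x\<^sub>1\<close> to \<open>0\<close> when \<open>x\<^sub>1\<close> is negative. It is taken with respect to
  \<^const>\<open>lebesgue\<close> rather than \<^const>\<open>lborel\<close>, since the slices of a Lebesgue measurable function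
  need not be Borel measurable. On the null set of \<open>x\<close> whose slice is not integrable, the value
  is the default \<open>0\<close> and carries no meaning.\<close>

definition first_index :: "'n::{finite,linorder}" where
  "first_index = Min UNIV"

definition P :: "(real^'n::{finite,linorder} \<Rightarrow> complex) \<Rightarrow> real^'n::{finite,linorder} \<Rightarrow> complex" where
  "P \<phi> x = (LINT t=0..ereal (x $ first_index)|lebesgue.
     \<phi> (\<chi> i. if i = first_index then t else x $ i))"

end

theory Submission imports Defs begin

text \<open>Let \<open>e\<close> be the first basis vector and \<open>F = f\<^sup>*\<close> an \<open>L\<^sup>1\<close> kernel of nonzero integral that
  annihilates \<open>\<phi>\<close>. For every \<open>T \<ge> 0\<close> the increment \<open>w x = g (x + T e) - g x\<close> is an integral of
  translates of \<open>\<phi>\<close>, hence bounded and annihilated by \<open>F\<close> too, so that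
  \<open>w x \<integral>F = \<integral> F (x - y) (w x - w y) dy\<close>. Since \<open>g\<close> is uniformly continuous, \<open>w x - w y\<close> is bounded
  for \<open>norm (x - y) \<le> R\<close> independently of \<open>T\<close>; choosing \<open>R\<close> so that \<open>F\<close> has little mass
  outside the ball of radius \<open>R\<close> bounds \<open>w\<close> uniformly in \<open>T\<close>. As \<open>g\<close> vanishes on \<open>x\<^sub>1 = 0\<close>, this
  bounds \<open>g\<close>.\<close>

section \<open>Null sets and integrals under reflections, translations and along lines\<close>

lemma distr_lborel_diff:
  fixes x :: "'a::euclidean_space"
  shows "distr lborel borel (\<lambda>y. x - y) = lborel"
proof -
  have "lborel = density (distr lborel borel (\<lambda>y. x + (-1::real) *\<^sub>R y)) (\<lambda>_. \<bar>-1::real\<bar>^DIM('a))"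
    by (rule lborel_affine) auto
  then show ?thesis by (simp add: density_1)
qed

lemma AE_lborel_diff:
  fixes x :: "'a::euclidean_space"
  assumes "AE y in lborel. Q y"
  shows "AE y in lborel. Q (x - y)"
proof -
  have "AE y in distr lborel borel (\<lambda>y. x - y). Q y"
    by (subst distr_lborel_diff) (rule assms)
  then show ?thesis by (rule AE_distrD[rotated]) simp
qed

lemma AE_lborel_plus:
  fixes a :: "'a::euclidean_space"
  assumes "AE y in lborel. Q y"
  shows "AE y in lborel. Q (y + a)"
proof -
  have "AE y in distr lborel borel ((+) a). Q y"
    by (subst lborel_distr_plus) (rule assms)
  then have "AE y in lborel. Q (a + y)" by (rule AE_distrD[rotated]) simp
  then show ?thesis by (simp add: add.commute)
qed

lemma lborel_integrable_diff:
  fixes x :: "'a::euclidean_space" and F :: "'a \<Rightarrow> 'b::{banach, second_countable_topology}"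
  assumes "integrable lborel F"
  shows "integrable lborel (\<lambda>y. F (x - y))"
proof -
  have "integrable (distr lborel borel (\<lambda>y. x - y)) F"
    using assms by (simp add: distr_lborel_diff)
  then show ?thesis by (rule integrable_distr[rotated]) simp
qed

lemma lborel_integral_diff:
  fixes x :: "'a::euclidean_space" and F :: "'a \<Rightarrow> 'b::{banach, second_countable_topology}"
  assumes "F \<in> borel_measurable borel"
  shows "(LINT y|lborel. F (x - y)) = (LINT y|lborel. F y)"
proof -
  have "integral\<^sup>L lborel F = integral\<^sup>L (distr lborel borel (\<lambda>y. x - y)) F"
    by (simp add: distr_lborel_diff)
  also have "\<dots> = (LINT y|lborel. F (x - y))"
    using assms by (subst integral_distr) auto
  finally show ?thesis ..
qed

lemma lborel_integral_plus:
  fixes a :: "'a::euclidean_space" and F :: "'a \<Rightarrow> 'b::{banach, second_countable_topology}"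
  assumes "F \<in> borel_measurable borel"
  shows "(LINT y|lborel. F (y + a)) = (LINT y|lborel. F y)"
proof -
  have "integral\<^sup>L lborel F = integral\<^sup>L (distr lborel borel ((+) a)) F"
    by (simp add: lborel_distr_plus)
  also have "\<dots> = (LINT y|lborel. F (a + y))"
    using assms by (subst integral_distr) auto
  finally show ?thesis by (simp add: add.commute)
qed

text \<open>Fubini: for each fixed \<open>t\<close> a translate of a null set is null, and the two
  almost-everywhere quantifiers are exchanged.\<close>

lemma AE_lborel_lines:
  fixes e :: "'a::euclidean_space"
  assumes "AE x in lborel. Q x"
  shows "AE x in lborel. AE t in lborel. Q (x + t *\<^sub>R e)"
proof -
  \<comment> \<open>The exchange requires a measurable predicate, which \<open>Q\<close> need not
    be; a Borel null set containing its exceptional points takes its place.\<close>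
  obtain N where N: "N \<in> null_sets lborel" "{x \<in> space lborel. \<not> Q x} \<subseteq> N"
    using AE_E[OF assms] by (metis null_setsI)
  then have [measurable]: "N \<in> sets borel" by auto
  have "AE t in lborel. AE x in lborel. x + t *\<^sub>R e \<notin> N"
    by (rule AE_I2, rule AE_lborel_plus, rule AE_not_in[OF N(1)])
  then have "AE x in lborel. AE t in (lborel::real measure). x + t *\<^sub>R e \<notin> N"
    by (subst (asm) lborel_pair.AE_commute) measurable
  then show ?thesis
    using N(2) by (auto elim!: eventually_mono)
qed

section \<open>Borel versions and comparison of continuous functions\<close>

lemma lebesgue_ex_borel_complex:
  fixes f :: "'a::euclidean_space \<Rightarrow> complex"
  assumes "f \<in> borel_measurable lebesgue"
  obtains f' where "f' \<in> borel_measurable borel" "AE x in lborel. f x = f' x"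
proof -
  have "(\<lambda>x. Re (f x)) \<in> borel_measurable lebesgue" "(\<lambda>x. Im (f x)) \<in> borel_measurable lebesgue"
    using assms by measurable
  from this[THEN completion_ex_borel_measurable_real]
  obtain r i where m: "r \<in> borel_measurable lborel" "AE x in lborel. Re (f x) = r x"
    "i \<in> borel_measurable lborel" "AE x in lborel. Im (f x) = i x"
    by auto
  show ?thesis
  proof
    show "(\<lambda>x. Complex (r x) (i x)) \<in> borel_measurable borel"
      using m by (simp add: Complex_eq)
    show "AE x in lborel. f x = Complex (r x) (i x)"
      using m(2,4) by eventually_elim (simp add: complex_eq_iff)
  qed
qed

text \<open>The points violating the inequality form an open null set, hence none exist. This turns
  almost-everywhere estimates into pointwise ones.\<close>

lemma AE_le_imp_le_continuous:
  fixes f :: "'a::euclidean_space \<Rightarrow> real"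
  assumes "continuous_on UNIV f" "continuous_on UNIV h" "AE x in lborel. f x \<le> h x"
  shows "f x \<le> h x"
proof -
  let ?S = "{x. h x < f x}"
  have o: "open ?S" using assms by (intro open_Collect_less)
  have "emeasure lborel ?S = 0"
    using assms(3) o by (subst (asm) AE_iff_measurable) (auto simp: not_le)
  then have "?S \<in> null_sets lebesgue"
    using o by (intro null_sets_completionI) auto
  then have "?S = {}"
    using open_not_negligible[OF o] by (auto simp: negligible_iff_null_sets)
  then show ?thesis by (metis (mono_tags) empty_iff linorder_not_le mem_Collect_eq)
qed

section \<open>Kernel tails, bounded increments and the absorption estimate\<close>

lemma integrable_norm_tail:
  fixes F :: "'a::euclidean_space \<Rightarrow> complex"
  assumes "integrable lborel F" "0 < \<epsilon>"
  obtains R where "(LINT y|lborel. indicator {y. R < norm y} y * norm (F y)) < \<epsilon>"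
proof -
  have [measurable]: "F \<in> borel_measurable borel" using assms by auto
  have "(\<lambda>k::nat. LINT y|lborel. indicator {y. real k < norm y} y * norm (F y)) \<longlonglongrightarrow> (LINT y::'a|lborel. 0)"
  proof (rule integral_dominated_convergence[where w="\<lambda>y. norm (F y)" and f="\<lambda>_. 0"
        and s="\<lambda>k y. indicator {y. real k < norm y} y * norm (F y)"])
    show "AE x in lborel. (\<lambda>k::nat. indicator {y. real k < norm y} x * norm (F x)) \<longlonglongrightarrow> 0"
    proof (rule AE_I2, rule tendsto_eventually)
      fix x :: 'a
      show "\<forall>\<^sub>F k in sequentially. indicator {y. real k < norm y} x * norm (F x) = 0"
        using eventually_ge_at_top[of "nat \<lceil>norm x\<rceil>"]
      proof eventually_elim
        fix k :: nat assume "nat \<lceil>norm x\<rceil> \<le> k"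
        then have "norm x \<le> real k" by linarith
        then show "indicator {y. real k < norm y} x * norm (F x) = 0" by simp
      qed
    qed
    show "integrable lborel (\<lambda>y. norm (F y))" using assms by auto
  qed (auto simp: indicator_def)
  then have "\<forall>\<^sub>F k::nat in sequentially. (LINT y|lborel. indicator {y. real k < norm y} y * norm (F y)) < \<epsilon>"
    using assms(2) by (intro order_tendstoD(2)) auto
  then obtain k :: nat where "(LINT y|lborel. indicator {y. real k < norm y} y * norm (F y)) < \<epsilon>"
    by (auto simp: eventually_sequentially)
  then show thesis by (rule that)
qed

text \<open>The segment from \<open>y\<close> to \<open>x\<close> is cut into \<open>k\<close> equal
  steps shorter than \<open>d\<close>, each changing \<open>g\<close> by less than 1;
  \<open>k\<close> depends on \<open>R\<close> and \<open>d\<close> but not on the points.\<close>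

lemma uniformly_continuous_bounded_increments:
  fixes g :: "'a::real_normed_vector \<Rightarrow> 'b::real_normed_vector"
  assumes "uniformly_continuous_on UNIV g"
  obtains B where "0 \<le> B" "\<And>x y. norm (x - y) \<le> R \<Longrightarrow> norm (g x - g y) \<le> B"
proof -
  obtain d where d: "d > 0" "\<And>x y. dist x y < d \<Longrightarrow> dist (g x) (g y) < 1"
    using assms unfolding uniformly_continuous_on_def by (metis UNIV_I zero_less_one)
  obtain k :: nat where k: "\<bar>R\<bar> / d < real k"
    using reals_Archimedean2 by blast
  have k0: "0 < k"
  proof (rule gr0I)
    assume "k = 0"
    moreover have "0 \<le> \<bar>R\<bar> / d" using d(1) by simp
    ultimately show False using k by simp
  qed
  then have k1: "\<bar>R\<bar> / real k < d" using k d(1) by (simp add: pos_divide_less_eq mult.commute)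
  show thesis
  proof (rule that[of "real k"])
    fix x y :: 'a assume xy: "norm (x - y) \<le> R"
    define v where "v = (x - y) /\<^sub>R real k"
    have v: "norm v < d"
    proof -
      have "norm v \<le> \<bar>R\<bar> / real k"
        using xy k0 by (simp add: v_def divide_simps)
      then show ?thesis using k1 by simp
    qed
    have "norm (g (y + real j *\<^sub>R v) - g y) \<le> real j" for j
    proof (induction j)
      case (Suc j)
      have "dist (y + real (Suc j) *\<^sub>R v) (y + real j *\<^sub>R v) < d"
        using v by (simp add: dist_norm algebra_simps)
      then have "norm (g (y + real (Suc j) *\<^sub>R v) - g (y + real j *\<^sub>R v)) < 1"
        using d(2) by (simp add: dist_norm)
      moreover have "norm (g (y + real (Suc j) *\<^sub>R v) - g y)
          \<le> norm (g (y + real (Suc j) *\<^sub>R v) - g (y + real j *\<^sub>R v)) + norm (g (y + real j *\<^sub>R v) - g y)"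
        by (rule order_trans[OF _ norm_triangle_ineq]) simp
      ultimately show ?case using Suc by simp
    qed simp
    from this[of k] show "norm (g x - g y) \<le> real k"
      using k0 by (simp add: v_def)
  qed simp
qed

text \<open>The far part of the kernel contributes at most half of the supremum of \<open>norm w\<close>, which is
  finite by the a priori bound \<open>M\<close> and is absorbed on the left; the bound obtained does not involve
  \<open>M\<close>.\<close>

lemma annihilated_imp_bound:
  fixes F w :: "'a::euclidean_space \<Rightarrow> complex"
  assumes F: "integrable lborel F" and I: "integral\<^sup>L lborel F \<noteq> 0"
    and w: "continuous_on UNIV w" "\<And>x. norm (w x) \<le> M"
    and zero: "AE x in lborel. (LINT y|lborel. F (x - y) * w y) = 0"
    and B: "0 \<le> B" "\<And>x y. norm (x - y) \<le> R \<Longrightarrow> norm (w x - w y) \<le> B"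
    and tail: "(LINT y|lborel. indicator {y. R < norm y} y * norm (F y)) \<le> norm (integral\<^sup>L lborel F) / 4"
  shows "norm (w x) \<le> 2 * B * (LINT y|lborel. norm (F y)) / norm (integral\<^sup>L lborel F)"
proof -
  define S where "S = (SUP x. norm (w x))"
  define I where "I = integral\<^sup>L lborel F"
  define A where "A = (LINT y|lborel. norm (F y))"
  have [measurable]: "F \<in> borel_measurable borel" "w \<in> borel_measurable borel"
    using F w borel_measurable_continuous_onI by auto
  have bdd: "bdd_above (range (\<lambda>x. norm (w x)))" using w(2) by (auto simp: bdd_above_def)
  have wS: "norm (w x) \<le> S" for x unfolding S_def by (intro cSUP_upper bdd) simp
  have S0: "0 \<le> S" using norm_ge_zero wS order_trans by blast
  have bound: "norm I * norm (w x) \<le> B * A + S * norm I / 2"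
    if z: "(LINT y|lborel. F (x - y) * w y) = 0" for x
  proof -
    have Fx: "integrable lborel (\<lambda>y. F (x - y))" by (rule lborel_integrable_diff[OF F])
    \<comment> \<open>The a priori bound \<open>M\<close> serves for integrability here and for the
      finiteness of \<open>S\<close>.\<close>
    have Fw: "integrable lborel (\<lambda>y. F (x - y) * w y)"
      by (rule Bochner_Integration.integrable_bound[of _ "\<lambda>y. M * F (x - y)"])
        (use Fx w(2) in \<open>auto simp: norm_mult mult.commute[of "norm (F _)"] simp del: minus_diff_eq
           intro!: AE_I2 mult_right_mono order_trans[OF w(2) abs_ge_self]\<close>)
    \<comment> \<open>Majorant of the integrand after reflection: \<open>B\<close> bounds the
      increment of \<open>w\<close> within radius \<open>R\<close>, and beyond it
      \<open>2 * S\<close> does.\<close>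
    let ?h = "\<lambda>y. B * norm (F y) + 2 * S * (indicator {y. R < norm y} y * norm (F y))"
    have ih: "integrable lborel (\<lambda>y. indicator {y. R < norm y} y * norm (F y))"
      by (rule Bochner_Integration.integrable_bound[OF integrable_norm[OF F]])
        (auto simp: indicator_def)
    have h: "integrable lborel ?h" using F ih by auto
    \<comment> \<open>The reflected kernel still has integral \<open>I\<close>, and the subtracted
      integral is zero by \<open>z\<close>; the difference involves only increments of
      \<open>w\<close>.\<close>
    have "I * w x = (LINT y|lborel. F (x - y) * w x) - (LINT y|lborel. F (x - y) * w y)"
      using z by (simp add: I_def lborel_integral_diff)
    also have "\<dots> = (LINT y|lborel. F (x - y) * (w x - w y))"
      using Fx Fw by (subst Bochner_Integration.integral_diff[symmetric]) (auto simp: algebra_simps)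
    finally have "norm (I * w x) = norm (LINT y|lborel. F (x - y) * (w x - w y))" by simp
    also have "\<dots> \<le> (LINT y|lborel. ?h (x - y))"
    proof (rule Bochner_Integration.integral_norm_bound_integral)
      show "integrable lborel (\<lambda>y. F (x - y) * (w x - w y))"
        using Fx Fw by (auto simp: algebra_simps)
      show "integrable lborel (\<lambda>y. ?h (x - y))" by (rule lborel_integrable_diff[OF h])
      fix y
      have "norm (w x - w y) \<le> S + S" by (rule order_trans[OF norm_triangle_ineq4 add_mono]) (rule wS)+
      then have "norm (w x - w y) \<le> B + 2 * S * indicator {y. R < norm y} (x - y)"
        using B(2)[of x y] B(1) by (auto simp: indicator_def not_less)
      then have "norm (F (x - y)) * norm (w x - w y)
          \<le> norm (F (x - y)) * (B + 2 * S * indicator {y. R < norm y} (x - y))"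
        by (intro mult_left_mono) auto
      then show "norm (F (x - y) * (w x - w y)) \<le> ?h (x - y)"
        unfolding norm_mult by (simp add: distrib_left mult_ac)
    qed
    also have "\<dots> = (LINT y|lborel. ?h y)" by (rule lborel_integral_diff) measurable
    also have "\<dots> = B * A + 2 * S * (LINT y|lborel. indicator {y. R < norm y} y * norm (F y))"
      using F ih by (simp add: A_def)
    also have "\<dots> \<le> B * A + 2 * S * (norm I / 4)"
      using tail S0 by (intro add_left_mono mult_left_mono) (auto simp: I_def)
    finally show ?thesis by (simp add: norm_mult)
  qed
  have Ip: "0 < norm I" using assms(2) by (simp add: I_def)
  \<comment> \<open>\<open>bound\<close> is available only where the convolution vanishes.
    Continuity extends it to all points, so that the supremum \<open>S\<close> obeys it too.\<close>
  have "norm I * norm (w x) \<le> B * A + S * norm I / 2" for x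
  proof (rule AE_le_imp_le_continuous[where f="\<lambda>x. norm I * norm (w x)"
        and h="\<lambda>_. B * A + S * norm I / 2"])
    show "continuous_on UNIV (\<lambda>x. norm I * norm (w x))" by (intro continuous_intros w(1))
    show "AE x in lborel. norm I * norm (w x) \<le> B * A + S * norm I / 2"
      using zero by eventually_elim (rule bound)
  qed (rule continuous_on_const)
  then have "norm (w x) \<le> (B * A + S * norm I / 2) / norm I" for x
    using Ip by (simp add: pos_le_divide_eq mult.commute)
  then have "S \<le> (B * A + S * norm I / 2) / norm I"
    unfolding S_def by (intro cSUP_least) auto
  then have "S \<le> 2 * B * A / norm I" using Ip by (simp add: field_simps)
  then show ?thesis using wS[of x] unfolding A_def I_def by linarith
qed


section \<open>From \<open>lebesgue\<close> to \<open>lborel\<close>, and oriented integrals\<close>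

text \<open>\<open>f\<close> inherits measurability from \<open>h\<close> because
  \<open>lebesgue\<close> is complete, and completion does not change the integral of a Borel
  function.\<close>

lemma integral_lebesgue_eq_lborel:
  fixes f h :: "'a::euclidean_space \<Rightarrow> complex"
  assumes "AE x in lborel. f x = h x" "h \<in> borel_measurable borel"
  shows "integral\<^sup>L lebesgue f = integral\<^sup>L lborel h"
proof -
  have h: "h \<in> borel_measurable lebesgue"
    using assms(2) by (simp add: measurable_completion)
  have eq: "AE x in lebesgue. f x = h x" "AE x in lebesgue. h x = f x"
    using assms(1) by (auto simp: AE_completion_iff eq_commute)
  have "integral\<^sup>L lebesgue f = integral\<^sup>L lebesgue h"
    using borel_measurable_AE[OF h eq(2)] h eq(1) by (rule integral_cong_AE)
  then show ?thesis using assms(2) by (simp add: integral_completion)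
qed

lemma interval_lebesgue_integral_lebesgue_eq_lborel:
  fixes f h :: "real \<Rightarrow> complex"
  assumes "AE t in lborel. f t = h t" "h \<in> borel_measurable borel"
  shows "(LINT t=a..b|lebesgue. f t) = (LBINT t=a..b. h t)"
proof -
  have "(LINT t:einterval c d|lebesgue. f t) = (LINT t:einterval c d|lborel. h t)" for c d
    unfolding set_lebesgue_integral_def
    by (rule integral_lebesgue_eq_lborel) (use assms in \<open>auto elim: eventually_mono\<close>)
  then show ?thesis by (simp add: interval_lebesgue_integral_def)
qed

lemma interval_lebesgue_integrable_bounded:
  fixes h :: "real \<Rightarrow> complex" and a b :: real
  assumes "h \<in> borel_measurable borel" "\<And>t. norm (h t) \<le> C"
  shows "interval_lebesgue_integrable lborel (ereal a) (ereal b) h"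
proof -
  have "set_integrable lborel {c<..<d} h" for c d :: real
    unfolding set_integrable_def
  proof (rule Bochner_Integration.integrable_bound[of _ "\<lambda>t. C * indicator {c<..<d} t"])
    show "integrable lborel (\<lambda>t. C * indicator {c<..<d} t)"
      by (intro integrable_mult_right integrable_real_indicator) (cases "c \<le> d"; auto)+
    show "AE t in lborel. norm (indicator {c<..<d} t *\<^sub>R h t) \<le> norm (C * indicator {c<..<d} t)"
      using assms(2) by (intro AE_I2) (auto simp: indicator_def intro: order_trans[OF _ abs_ge_self])
  qed (use assms in measurable)
  then show ?thesis by (simp add: interval_lebesgue_integrable_def)
qed

text \<open>Additivity of the oriented integral covers all signs of \<open>a\<close> and
  \<open>a + T\<close>. Shifting the window to \<open>{0<..<T}\<close> removes \<open>a\<close> from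
  the domain of integration, which prepares the use of Fubini.\<close>

lemma interval_integral_increment:
  fixes h :: "real \<Rightarrow> complex" and a T :: real
  assumes "h \<in> borel_measurable borel" "\<And>t. norm (h t) \<le> C" "0 \<le> T"
  shows "(LBINT t=0..ereal (a + T). h t) - (LBINT t=0..ereal a. h t)
    = (LINT t|lborel. indicator {0<..<T} t *\<^sub>R h (a + t))"
proof -
  \<comment> \<open>The endpoints 0, \<open>a\<close> and \<open>a + T\<close> come in several
    orders, so integrability is established on their hull.\<close>
  have "interval_lebesgue_integrable lborel (min 0 (min (ereal a) (ereal (a+T))))
      (max 0 (max (ereal a) (ereal (a+T)))) h"
    using interval_lebesgue_integrable_bounded[OF assms(1,2), of "min 0 (min a (a+T))" "max 0 (max a (a+T))"]
    by (simp add: zero_ereal_def)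
  then have "(LBINT t=0..ereal (a + T). h t) - (LBINT t=0..ereal a. h t) = (LBINT t=ereal a..ereal (a+T). h t)"
    using interval_integral_sum[of 0 "ereal a" "ereal (a+T)" h] by (simp add: algebra_simps)
  also have "\<dots> = (LINT t|lborel. indicator {a<..<a+T} t *\<^sub>R h t)"
    using assms(3) by (simp add: interval_lebesgue_integral_def set_lebesgue_integral_def)
  also have "\<dots> = (LINT t|lborel. indicator {a<..<a+T} (a + 1 * t) *\<^sub>R h (a + 1 * t))"
    by (subst lborel_integral_real_affine[of 1 _ a]) auto
  also have "\<dots> = (LINT t|lborel. indicator {0<..<T} t *\<^sub>R h (a + t))"
    by (intro Bochner_Integration.integral_cong) (auto simp: indicator_def)
  finally show ?thesis .
qed

lemma norm_window_integral_le:
  fixes h :: "real \<Rightarrow> complex"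
  assumes "h \<in> borel_measurable borel" "\<And>t. norm (h t) \<le> C" "0 \<le> T"
  shows "norm (LINT t|lborel. indicator {0<..<T} t *\<^sub>R h t) \<le> C * T"
proof -
  have "set_integrable lborel {0<..<T} h"
    using interval_lebesgue_integrable_bounded[OF assms(1,2), of 0 T] assms(3)
    by (simp add: interval_lebesgue_integrable_def zero_ereal_def)
  then have "norm (LINT t|lborel. indicator {0<..<T} t *\<^sub>R h t)
      \<le> (LINT t|lborel. C * indicator {0<..<T} t)"
  proof (intro Bochner_Integration.integral_norm_bound_integral)
    show "integrable lborel (\<lambda>t. C * indicator {0<..<T} t)"
      using assms(3) by (intro integrable_mult_right integrable_real_indicator) auto
  qed (use assms(2) in \<open>auto simp: set_integrable_def indicator_def\<close>)
  also have "\<dots> = C * T" using assms(3) by simp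
  finally show ?thesis .
qed

section \<open>Annihilation passes to integrals of translates\<close>

text \<open>By Fubini the integral at \<open>x\<close> is the integral over \<open>t\<close> of the
  convolutions of \<open>F\<close> and \<open>\<psi>\<close> at \<open>x + t *\<^sub>R e\<close>,
  and for almost every \<open>x\<close> these vanish for almost every \<open>t\<close>.\<close>

lemma annihilates_window_integral:
  fixes F \<psi> :: "'a::euclidean_space \<Rightarrow> complex" and e :: 'a
  assumes F: "integrable lborel F"
    and \<psi>[measurable]: "\<psi> \<in> borel_measurable borel" and C: "\<And>x. norm (\<psi> x) \<le> C"
    and T: "0 \<le> T"
    and zero: "AE x in lborel. (LINT y|lborel. F (x - y) * \<psi> y) = 0"
  shows "AE x in lborel.
    (LINT y|lborel. F (x - y) * (LINT t|lborel. indicator {0<..<T} t *\<^sub>R \<psi> (y + t *\<^sub>R e))) = 0"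
  using AE_lborel_lines[OF zero, of e]
proof eventually_elim
  fix x assume z: "AE t in lborel. (LINT y|lborel. F (x + t *\<^sub>R e - y) * \<psi> y) = 0"
  have [measurable]: "F \<in> borel_measurable borel" using F by auto
  let ?G = "\<lambda>y t. indicator {0<..<T} t *\<^sub>R (F (x - y) * \<psi> (y + t *\<^sub>R e))"
  have C0: "0 \<le> C" using C norm_ge_zero order_trans by blast
  have Fx: "integrable lborel (\<lambda>y. F (x - y))" by (rule lborel_integrable_diff[OF F])
  \<comment> \<open>A product of an integrable function of \<open>y\<close> and one of
    \<open>t\<close> dominates \<open>?G\<close> and justifies the exchange of integrals.\<close>
  have "integrable (lborel \<Otimes>\<^sub>M lborel) (case_prod (\<lambda>y t. C * norm (F (x - y)) * indicator {0<..<T} t))"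
    by (rule lborel_pair.Fubini_integrable) (use Fx T in \<open>auto simp: abs_mult\<close>)
  then have G: "integrable (lborel \<Otimes>\<^sub>M lborel) (case_prod ?G)"
  proof (rule Bochner_Integration.integrable_bound)
    show "case_prod ?G \<in> borel_measurable (lborel \<Otimes>\<^sub>M lborel)" by measurable
    have "norm (F (x - y)) * norm (\<psi> (y + t *\<^sub>R e)) \<le> C * norm (F (x - y))" for y t
      using mult_right_mono[OF C norm_ge_zero] by (subst mult.commute)
    then show "AE p in lborel \<Otimes>\<^sub>M lborel. norm (case p of (y, t) \<Rightarrow> ?G y t)
        \<le> norm (case p of (y, t) \<Rightarrow> C * norm (F (x - y)) * indicator {0<..<T} t)"
      using C0 by (intro AE_I2) (auto simp: indicator_def norm_mult)
  qed
  have "(LINT y|lborel. F (x - y) * (LINT t|lborel. indicator {0<..<T} t *\<^sub>R \<psi> (y + t *\<^sub>R e)))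
      = (LINT y|lborel. LINT t|lborel. ?G y t)"
    by (simp flip: integral_mult_right_zero)
  also have "\<dots> = (LINT t|lborel. LINT y|lborel. ?G y t)"
    using lborel_pair.Fubini_integral[OF G] by simp
  also have "\<dots> = (LINT t|(lborel::real measure). 0)"
  proof (rule integral_cong_AE)
    show "AE t in lborel. (LINT y|lborel. ?G y t) = 0"
      using z
    proof eventually_elim
      fix t assume z: "(LINT y|lborel. F (x + t *\<^sub>R e - y) * \<psi> y) = 0"
      \<comment> \<open>Translation in \<open>y\<close> moves the shift from \<open>\<psi>\<close>
        to the kernel.\<close>
      have "(LINT y|lborel. F (x + t *\<^sub>R e - (y + t *\<^sub>R e)) * \<psi> (y + t *\<^sub>R e))
          = (LINT y|lborel. F (x + t *\<^sub>R e - y) * \<psi> y)"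
        by (rule lborel_integral_plus) measurable
      then show "(LINT y|lborel. ?G y t) = 0" using z by simp
    qed
  qed measurable
  finally show "(LINT y|lborel. F (x - y) * (LINT t|lborel. indicator {0<..<T} t *\<^sub>R \<psi> (y + t *\<^sub>R e))) = 0"
    by simp
qed

section \<open>Line integrals for \<open>P\<close> and representatives of the data\<close>

text \<open>Written as a motion along the first basis vector, the slice becomes accessible to the
  results on lines.\<close>

lemma P_eq_line_integral:
  "P \<phi> x = (LINT t=0..ereal (x $ first_index)|lebesgue.
     \<phi> (x + (t - x $ first_index) *\<^sub>R axis first_index 1))"
proof -
  have "(\<chi> i. if i = first_index then t else x $ i) = x + (t - x $ first_index) *\<^sub>R axis first_index 1" for t
    by (auto simp: vec_eq_iff axis_def)
  then show ?thesis by (simp add: P_def)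
qed

text \<open>On almost every line the slices of \<open>\<phi>\<close> and \<open>\<psi>\<close> agree
  almost everywhere, so their integrals coincide.\<close>

lemma AE_P_eq_borel:
  fixes \<phi> \<psi> :: "real^'n::{finite,linorder} \<Rightarrow> complex"
  assumes "AE x in lborel. \<phi> x = \<psi> x" and [measurable]: "\<psi> \<in> borel_measurable borel"
  shows "AE x in lborel. P \<phi> x = (LBINT t=0..ereal (x $ first_index).
     \<psi> (x + (t - x $ first_index) *\<^sub>R axis first_index 1))"
  using AE_lborel_lines[OF assms(1), of "axis first_index 1"]
proof eventually_elim
  fix x :: "(real, 'n) vec"
  assume "AE t in lborel. \<phi> (x + t *\<^sub>R axis first_index 1) = \<psi> (x + t *\<^sub>R axis first_index 1)"
  from AE_lborel_plus[OF this, of "- x $ first_index"]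
  show "P \<phi> x = (LBINT t=0..ereal (x $ first_index).
     \<psi> (x + (t - x $ first_index) *\<^sub>R axis first_index 1))"
    unfolding P_eq_line_integral
    by (intro interval_lebesgue_integral_lebesgue_eq_lborel) auto
qed

lemma L_infinity_borel_representative:
  assumes "L_infinity \<phi>"
  obtains \<psi> C where "\<psi> \<in> borel_measurable borel" "AE x in lborel. \<phi> x = \<psi> x" "\<And>x. norm (\<psi> x) \<le> C"
proof -
  obtain C where C: "AE x in lborel. norm (\<phi> x) \<le> C"
    using assms by (auto simp: L_infinity_def AE_completion_iff)
  obtain h where h[measurable]: "h \<in> borel_measurable borel" and eq: "AE x in lborel. \<phi> x = h x"
    using assms lebesgue_ex_borel_complex unfolding L_infinity_def by blast
  show thesis
  \<comment> \<open>Truncation makes the bound hold everywhere; \<open>max C 0\<close> also covers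
    the value 0, as \<open>C\<close> carries no sign.\<close>
  proof (rule that[of "\<lambda>x. if norm (h x) \<le> C then h x else 0" "max C 0"])
    show "AE x in lborel. \<phi> x = (if norm (h x) \<le> C then h x else 0)"
      using C eq by eventually_elim auto
  qed auto
qed

text \<open>Reflection preserves the integral, conjugation passes through it, and the Fourier
  transform at 0 is the plain integral. A transform that is nonzero at 0 thus yields a kernel of
  nonzero integral.\<close>

lemma star_borel_representative:
  assumes "L_one f"
  obtains F where "integrable lborel F" "AE x in lborel. star f x = F x"
    "integral\<^sup>L lborel F = cnj (fourier f 0)"
proof -
  have f: "integrable lebesgue f" using assms by (simp add: L_one_def)
  obtain h where h[measurable]: "h \<in> borel_measurable borel" and eq: "AE x in lborel. f x = h x"
    using lebesgue_ex_borel_complex[OF borel_measurable_integrable[OF f]] by blast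
  have "integrable lebesgue h"
  proof (rule integrable_cong_AE_imp[OF f])
    show "h \<in> borel_measurable lebesgue" using h by (simp add: measurable_completion)
    show "AE x in lebesgue. f x = h x" using eq by (simp add: AE_completion_iff)
  qed
  then have ih: "integrable lborel h" by (simp add: integrable_completion)
  have ih': "integrable lborel (\<lambda>x. h (- x))"
    using lborel_integrable_diff[OF ih, of 0] by simp
  show thesis
  proof (rule that[of "\<lambda>x. cnj (h (- x))"])
    show "integrable lborel (\<lambda>x. cnj (h (- x)))" using ih' by simp
    show "AE x in lborel. star f x = cnj (h (- x))"
      using AE_lborel_diff[OF eq, of 0] by (auto simp: star_def elim: eventually_mono)
    have "(LINT x|lborel. h (- x)) = integral\<^sup>L lborel h"
      using lborel_integral_diff[of h 0] by simp
    also have "\<dots> = fourier f 0"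
      using integral_lebesgue_eq_lborel[OF eq h] by (simp add: fourier_def)
    finally show "(LINT x|lborel. cnj (h (- x))) = cnj (fourier f 0)" by simp
  qed
qed

text \<open>For each fixed \<open>x\<close> the reflection of a null set is null, hence equality at
  every \<open>x\<close>.\<close>

lemma conv_eq_borel:
  assumes "AE x in lborel. k x = F x" "AE x in lborel. \<phi> x = \<psi> x"
    and [measurable]: "F \<in> borel_measurable borel" "\<psi> \<in> borel_measurable borel"
  shows "conv k \<phi> x = (LINT y|lborel. F (x - y) * \<psi> y)"
  unfolding conv_def
proof (rule integral_lebesgue_eq_lborel)
  show "AE y in lborel. k (x - y) * \<phi> y = F (x - y) * \<psi> y"
    using AE_lborel_diff[OF assms(1), of x] assms(2) by eventually_elim simp
qed measurable

section \<open>Uniform bound for the primitive\<close>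

text \<open>Membership of \<open>P \<phi>\<close> in the uniformly continuous functions is read
  modulo null sets: \<open>g\<close> is its uniformly continuous representative, and boundedness is
  asserted of \<open>g\<close>.\<close>

theorem theorem5p3:
  fixes \<phi> g :: "real^'n::{finite,linorder} \<Rightarrow> complex"
  assumes "L_infinity \<phi>"
    and "0 \<notin> sp \<phi>"
    and "uniformly_continuous_on UNIV g"
    and "AE x in lebesgue. P \<phi> x = g x"
  shows "bounded (range g)"
proof -
  define e :: "(real, 'n) vec" where "e = axis first_index 1"
  obtain \<psi> C where \<psi>[measurable]: "\<psi> \<in> borel_measurable borel"
    and \<phi>\<psi>: "AE x in lborel. \<phi> x = \<psi> x" and C: "\<And>x. norm (\<psi> x) \<le> C"
    using L_infinity_borel_representative[OF assms(1)] by blast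
  obtain f where f: "L_one f" "AE x in lborel. conv (star f) \<phi> x = 0" "fourier f 0 \<noteq> 0"
    using assms(2) by (auto simp: sp_def AE_completion_iff)
  obtain F where F: "integrable lborel F" "AE x in lborel. star f x = F x"
    and F0: "integral\<^sup>L lborel F = cnj (fourier f 0)"
    using star_borel_representative[OF f(1)] by blast
  have [measurable]: "F \<in> borel_measurable borel" using F by auto
  have I: "integral\<^sup>L lborel F \<noteq> 0" using F0 f(3) by simp
  have F\<psi>: "AE x in lborel. (LINT y|lborel. F (x - y) * \<psi> y) = 0"
    using f(2) by (simp add: conv_eq_borel[OF F(2) \<phi>\<psi>])
  \<comment> \<open>\<open>Q\<close> is the primitive formed from \<open>\<psi>\<close>. Its
    increments along \<open>e\<close> are computable at every point, whereas \<open>g\<close> equals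
    it only almost everywhere.\<close>
  define Q where "Q x = (LBINT t=0..ereal (x $ first_index). \<psi> (x + (t - x $ first_index) *\<^sub>R e))" for x
  have gQ: "AE x in lborel. g x = Q x"
    using AE_P_eq_borel[OF \<phi>\<psi> \<psi>] assms(4) unfolding AE_completion_iff
    by eventually_elim (simp add: Q_def e_def)
  have cg: "continuous_on UNIV g" by (rule uniformly_continuous_imp_continuous[OF assms(3)])
  have e1: "e $ first_index = 1" by (simp add: e_def)

  \<comment> \<open>Moving \<open>x\<close> along \<open>e\<close> changes only the upper limit; the
    integrand stays on the same line.\<close>
  have Q_incr: "Q (x + T *\<^sub>R e) - Q x = (LINT t|lborel. indicator {0<..<T} t *\<^sub>R \<psi> (x + t *\<^sub>R e))"
    if "0 \<le> T" for x T
    using interval_integral_increment[of "\<lambda>t. \<psi> (x + (t - x $ first_index) *\<^sub>R e)" C T "x $ first_index"] C that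
    by (simp add: Q_def e1 algebra_simps)

  obtain R where R: "(LINT y|lborel. indicator {y. R < norm y} y * norm (F y)) < norm (integral\<^sup>L lborel F) / 4"
    using integrable_norm_tail[OF F(1), of "norm (integral\<^sup>L lborel F) / 4"] I by auto
  obtain B where B: "0 \<le> B" "\<And>x y. norm (x - y) \<le> R \<Longrightarrow> norm (g x - g y) \<le> B"
    using uniformly_continuous_bounded_increments[OF assms(3)] by blast
  \<comment> \<open>An increment of \<open>w\<close> combines two increments of \<open>g\<close>,
    hence \<open>2 * B\<close>. No \<open>T\<close> enters.\<close>
  define K where "K = 2 * (2 * B) * (LINT y|lborel. norm (F y)) / norm (integral\<^sup>L lborel F)"

  have incr: "norm (g (x + T *\<^sub>R e) - g x) \<le> K" if T: "0 \<le> T" for x T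
    unfolding K_def
  \<comment> \<open>The a priori bound \<open>C * T\<close> grows with \<open>T\<close> but leaves
    no trace in the conclusion.\<close>
  proof (rule annihilated_imp_bound[where w="\<lambda>x. g (x + T *\<^sub>R e) - g x" and R=R and M="C * T"])
    have wW: "AE x in lborel. g (x + T *\<^sub>R e) - g x
        = (LINT t|lborel. indicator {0<..<T} t *\<^sub>R \<psi> (x + t *\<^sub>R e))"
      using AE_lborel_plus[OF gQ, of "T *\<^sub>R e"] gQ
      by eventually_elim (simp add: Q_incr[OF T])
    show cw: "continuous_on UNIV (\<lambda>x. g (x + T *\<^sub>R e) - g x)"
      by (intro continuous_intros continuous_on_compose2[OF cg]) auto
    then have [measurable]: "(\<lambda>x. g (x + T *\<^sub>R e) - g x) \<in> borel_measurable borel"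
      by (rule borel_measurable_continuous_onI)
    have "AE x in lborel. norm (g (x + T *\<^sub>R e) - g x) \<le> C * T"
      using wW by eventually_elim (use C T in \<open>auto intro!: norm_window_integral_le\<close>)
    then show "norm (g (x + T *\<^sub>R e) - g x) \<le> C * T" for x
      by (rule AE_le_imp_le_continuous[rotated 2]) (intro continuous_intros cw)+
    show "norm ((g (x + T *\<^sub>R e) - g x) - (g (y + T *\<^sub>R e) - g y)) \<le> 2 * B" if "norm (x - y) \<le> R" for x y
    proof -
      have "norm ((g (x + T *\<^sub>R e) - g (y + T *\<^sub>R e)) - (g x - g y)) \<le> B + B"
        by (rule order_trans[OF norm_triangle_ineq4 add_mono]) (use that in \<open>auto intro!: B(2)\<close>)
      then show ?thesis by (simp add: algebra_simps)
    qed
    show "AE x in lborel. (LINT y|lborel. F (x - y) * (g (y + T *\<^sub>R e) - g y)) = 0"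
      using annihilates_window_integral[OF F(1) \<psi> C T F\<psi>, of e]
    proof eventually_elim
      fix x
      assume z: "(LINT y|lborel. F (x - y) * (LINT t|lborel. indicator {0<..<T} t *\<^sub>R \<psi> (y + t *\<^sub>R e))) = 0"
      have "(LINT y|lborel. F (x - y) * (g (y + T *\<^sub>R e) - g y))
        = (LINT y|lborel. F (x - y) * (LINT t|lborel. indicator {0<..<T} t *\<^sub>R \<psi> (y + t *\<^sub>R e)))"
        using wW by (intro integral_cong_AE) (auto elim: eventually_mono)
      then show "(LINT y|lborel. F (x - y) * (g (y + T *\<^sub>R e) - g y)) = 0" using z by simp
    qed
  qed (use F I B R in auto)

  \<comment> \<open>The hyperplane of vanishing first coordinate is null, so the equality of
    \<open>g\<close> and \<open>Q\<close> almost everywhere says nothing there. A linear growth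
    bound passes to \<open>g\<close> almost everywhere, then everywhere by continuity, and forces
    \<open>g\<close> to vanish on the hyperplane.\<close>
  have "norm (Q x) \<le> C * \<bar>x $ first_index\<bar>" for x
  proof (cases "0 \<le> x $ first_index")
    case True
    let ?y = "x + (- x $ first_index) *\<^sub>R e"
    have "Q ?y = 0" by (simp add: Q_def e_def flip: zero_ereal_def)
    then show ?thesis
      using Q_incr[OF True, of ?y] norm_window_integral_le[of "\<lambda>t. \<psi> (?y + t *\<^sub>R e)" C, OF _ C True] True
      by simp
  next
    case False
    then have T: "0 \<le> - x $ first_index" by simp
    have "Q (x + (- x $ first_index) *\<^sub>R e) = 0" by (simp add: Q_def e_def flip: zero_ereal_def)
    then show ?thesis
      using Q_incr[OF T, of x] norm_window_integral_le[of "\<lambda>t. \<psi> (x + t *\<^sub>R e)" C, OF _ C T] False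
        norm_minus_cancel[of "Q x"] by simp
  qed
  then have "AE x in lborel. norm (g x) \<le> C * \<bar>x $ first_index\<bar>"
    using gQ by (auto elim!: eventually_mono)
  then have g_le: "norm (g x) \<le> C * \<bar>x $ first_index\<bar>" for x
    by (rule AE_le_imp_le_continuous[rotated 2]) (intro continuous_intros cg)+
  have g0: "g (x + (- x $ first_index) *\<^sub>R e) = 0" for x
    using g_le[of "x + (- x $ first_index) *\<^sub>R e"] by (simp add: e_def)

  \<comment> \<open>\<open>incr\<close> requires a nonnegative \<open>T\<close>: the increment
    starts at the projection of \<open>x\<close> onto the hyperplane if the first coordinate is
    nonnegative, and otherwise at \<open>x\<close> itself.\<close>
  have "norm (g x) \<le> K" for x
  proof (cases "0 \<le> x $ first_index")
    case True
    then show ?thesis using incr[OF True, of "x + (- x $ first_index) *\<^sub>R e"] g0[of x] by simp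
  next
    case False
    then show ?thesis using incr[of "- x $ first_index" x] g0[of x] by simp
  qed
  then show ?thesis by (auto simp: bounded_iff)
qed

end
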